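(* Suppose $F$, $\tilde F$ and the noise $w_k$ satisfy the following assumptions. (1) $F$ is $c$-strongly convex and differentiable on $\mathbb{R}^n$ with $L$-Lipschitz continuous gradient, and $\tilde F(\cdot,\xi)$ is convex for every $\xi\in\mathbb{R}^d$. (2) For all $k\ge 1$, $\mathbb{E}[w_k\mid\mathcal{F}_k]=0$ a.s., and there exist scalars $v_1,v_2>0$ such that for all $k\ge1$, $\mathbb{E}[\|w_k\|^2\mid\mathcal{F}_k]\le v_1\|x_k\|^2+v_2$ a.s. Let $\{x_k\}_{k\ge1}$ be generated by the stochastic approximation scheme $x_{k+1}=x_k-\gamma_k\nabla_x\tilde F(x_k,\xi_k)$ with $\gamma_k=\gamma_0/k$, where $\gamma_0>\frac{1}{2c}$. Fix any $r>0$ and let $M=L^2+v_1(1+\frac1r)$, $C=v_1(1+r)\|x^*\|^2+v_2$, and $e_k=\mathbb{E}[\|x_k-x^*\|^2]$. Let $$K=\left\lceil\frac{\gamma_0^2M}{2c\gamma_0-1}\right\rceil+1,\qquad Q(\gamma_0,K)=\max\left\{\frac{\gamma_0^2C}{2c\gamma_0-\gamma_0^2M/K-1},\;K e_K\right\}.$$ Then $$e_k\le\frac{Q(\gamma_0,K)}{k}\qquad\text{for any }k\ge K.$$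
   Context: Consider the unconstrained stochastic program $\min_{x\in\mathbb{R}^n}F(x)$, where $F(x)=\mathbb{E}[\tilde F(x,\xi)]$, $\xi:\Omega\to\mathbb{R}^d$ is a random vector on a probability space $(\Omega,\mathcal{F},\mathbb{P})$ and $\tilde F:\mathbb{R}^n\times\mathbb{R}^d\to\mathbb{R}$. Let $x^*$ denote the unique minimizer of $F$. The sequence $\xi_1,\xi_2,\dots$ is a sequence of random variables (the realizations of $\xi$ used by the scheme), and $\nabla_x\tilde F(x,\xi)$ denotes the gradient of $\tilde F(\cdot,\xi)$ at $x$. The history is $\mathcal{F}_1=\{x_1\}$ and $\mathcal{F}_k=\{x_1,\xi_1,\dots,\xi_{k-1}\}$ for $k\ge2$; conditioning on $\mathcal{F}_k$ means conditioning on the generated $\sigma$-algebra. The noise is $w_k=\nabla_x\tilde F(x_k,\xi_k)-\nabla F(x_k)$. *)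

theory Defs
  imports "HOL-Probability.Probability"
begin

text \<open>Only meaningful at points of differentiability, where the vector is unique.\<close>

definition grad :: "('a::euclidean_space \<Rightarrow> real) \<Rightarrow> 'a \<Rightarrow> 'a" where
  "grad f x = (THE g. GDERIV f x :> g)"

definition strongly_convex_on :: "'a::real_normed_vector set \<Rightarrow> real \<Rightarrow> ('a \<Rightarrow> real) \<Rightarrow> bool" where
  "strongly_convex_on S c f \<longleftrightarrow> convex S \<and> c > 0 \<and>
     (\<forall>x\<in>S. \<forall>y\<in>S. \<forall>t\<in>{0..1}.
        f ((1 - t) *\<^sub>R x + t *\<^sub>R y)
          \<le> (1 - t) * f x + t * f y - c / 2 * t * (1 - t) * (norm (x - y))\<^sup>2)"

text \<open>The sigma-algebra generated by \<open>x 1\<close> and \<open>\<xi> 1, \<dots>, \<xi> (k - 1)\<close>, as a measure space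
  on \<open>space P\<close>. Indices start at 1.\<close>

definition history ::
  "'w measure \<Rightarrow> (nat \<Rightarrow> 'w \<Rightarrow> 'a::topological_space) \<Rightarrow> (nat \<Rightarrow> 'w \<Rightarrow> 'b::topological_space)
     \<Rightarrow> nat \<Rightarrow> 'w measure" where
  "history P x \<xi> k = sigma (space P)
     ({x 1 -` A \<inter> space P | A. A \<in> sets borel} \<union>
      {\<xi> i -` A \<inter> space P | i A. 1 \<le> i \<and> i < k \<and> A \<in> sets borel})"

text \<open>Componentwise, since \<^const>\<open>real_cond_exp\<close> is for real-valued functions.\<close>

definition vec_cond_exp ::
  "'w measure \<Rightarrow> 'w measure \<Rightarrow> ('w \<Rightarrow> real ^ 'n) \<Rightarrow> 'w \<Rightarrow> real ^ 'n" where
  "vec_cond_exp P G f \<omega> = (\<chi> i. real_cond_exp P G (\<lambda>\<omega>'. f \<omega>' $ i) \<omega>)"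

end

theory Submission
  imports Defs
begin

text \<open>Stochastic approximation with steps \<open>\<gamma>\<^sub>0/k\<close> has mean square error of order \<open>1/k\<close>.

  Write \<open>x\<^sub>k\<^sub>+\<^sub>1 - x\<^sup>* = U - \<gamma>\<^sub>k w\<^sub>k\<close> with \<open>U = (x\<^sub>k - x\<^sup>*) - \<gamma>\<^sub>k \<nabla>F(x\<^sub>k)\<close>. The vector \<open>U\<close> is
  determined by the history, and \<open>w\<^sub>k\<close> is centred given the history, so the cross term has
  expectation zero. Since \<open>\<nabla>F(x\<^sup>*) = 0\<close>, strong convexity gives
  \<open>(x - x\<^sup>*) \<bullet> \<nabla>F(x) \<ge> c \<parallel>x - x\<^sup>*\<parallel>\<^sup>2\<close> and the Lipschitz condition gives
  \<open>\<parallel>\<nabla>F(x)\<parallel> \<le> L \<parallel>x - x\<^sup>*\<parallel>\<close>; the conditional variance bound is integrated and split with weight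
  \<open>r\<close>. Together (\<open>mean_square_error_step\<close>),
  \<open>e\<^sub>k\<^sub>+\<^sub>1 \<le> (1 - 2c\<gamma>\<^sub>k + M\<gamma>\<^sub>k\<^sup>2) e\<^sub>k + C\<gamma>\<^sub>k\<^sup>2\<close>.

  With \<open>\<gamma>\<^sub>k = \<gamma>\<^sub>0/k\<close> the contraction per step is about \<open>2c\<gamma>\<^sub>0/k\<close>, which beats the decay
  \<open>1/k\<close> of the target \<open>Q/k\<close> because \<open>2c\<gamma>\<^sub>0 > 1\<close>. The index \<open>K\<close> is chosen so that the
  second-order term \<open>M\<gamma>\<^sub>0\<^sup>2/k\<close> no longer consumes this surplus, and \<open>Q\<close> so that the surplus
  absorbs the noise; induction then propagates \<open>e\<^sub>k \<le> Q/k\<close> from \<open>K\<close> onwards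
  (\<open>Chung_recursion_bound\<close>).

  The remaining work is to justify the cross term: \<open>x\<^sub>k\<close> has to be measurable with respect to the
  history, which is an induction along the scheme, and for this a gradient of a sampled function at
  a random point has to be a random variable (\<open>measurable_grad_compose\<close>). Finiteness of the second
  moments is inherited along the recursion; if \<open>e\<^sub>K\<close> is infinite, so is the bound.\<close>

section \<open>Gradients and strong convexity\<close>

lemma GDERIV_grad:
  fixes f :: "'a::euclidean_space \<Rightarrow> real"
  assumes "f differentiable (at x)"
  shows "GDERIV f x :> grad f x"
proof -
  obtain f' where f': "(f has_derivative f') (at x)"
    using assms by (auto simp: differentiable_def)
  then have lin: "linear f'"
    by (rule has_derivative_linear)
  have f'_inner: "f' = (\<lambda>h. h \<bullet> (\<Sum>b\<in>Basis. f' b *\<^sub>R b))"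
  proof
    fix h :: 'a
    have "f' h = f' (\<Sum>b\<in>Basis. (h \<bullet> b) *\<^sub>R b)"
      by (simp add: euclidean_representation)
    also have "\<dots> = (\<Sum>b\<in>Basis. (h \<bullet> b) * f' b)"
      by (simp add: linear_sum[OF lin] linear_cmul[OF lin])
    finally show "f' h = h \<bullet> (\<Sum>b\<in>Basis. f' b *\<^sub>R b)"
      by (simp add: inner_sum_right mult.commute)
  qed
  have ex: "GDERIV f x :> (\<Sum>b\<in>Basis. f' b *\<^sub>R b)"
    unfolding gderiv_def using f' f'_inner by simp
  have unique: "g = g'" if "GDERIV f x :> g" "GDERIV f x :> g'" for g g'
  proof -
    have "(\<lambda>h. h \<bullet> g) = (\<lambda>h. h \<bullet> g')"
      using that unfolding gderiv_def by (rule has_derivative_unique)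
    then show ?thesis
      by (metis vector_eq_ldot inner_commute)
  qed
  show ?thesis
    unfolding grad_def by (rule theI[of _ "\<Sum>b\<in>Basis. f' b *\<^sub>R b"]) (auto intro: ex unique)
qed

lemma DERIV_along_line:
  fixes f :: "'a::euclidean_space \<Rightarrow> real"
  assumes "f differentiable (at x)"
  shows "((\<lambda>t. f (x + t *\<^sub>R d)) has_real_derivative (grad f x \<bullet> d)) (at 0)"
proof -
  have "(f has_derivative (\<lambda>h. h \<bullet> grad f x)) (at (x + 0 *\<^sub>R d))"
    using GDERIV_grad[OF assms] by (simp add: gderiv_def)
  moreover have "((\<lambda>t. x + t *\<^sub>R d) has_derivative (\<lambda>t. t *\<^sub>R d)) (at (0::real))"
    by (auto intro!: derivative_eq_intros)
  ultimately have "((\<lambda>t. f (x + t *\<^sub>R d)) has_derivative (\<lambda>t. (t *\<^sub>R d) \<bullet> grad f x)) (at 0)"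
    by (rule has_derivative_compose[rotated])
  then show ?thesis
    unfolding has_field_derivative_def
    by (rule has_derivative_eq_rhs) (auto simp: inner_commute mult.commute)
qed

lemma grad_eq_0_at_minimum:
  fixes f :: "'a::euclidean_space \<Rightarrow> real"
  assumes "f differentiable (at x)" and "\<And>y. f x \<le> f y"
  shows "grad f x = 0"
proof -
  have "(\<lambda>h. h \<bullet> grad f x) = (\<lambda>h. 0)"
    using GDERIV_grad[OF assms(1)] assms(2)
    unfolding gderiv_def by (intro differential_zero_maxmin[of x UNIV f]) auto
  then show ?thesis
    by (metis inner_eq_zero_iff)
qed

text \<open>The gap between the two sides of the strong convexity inequality along the segment from
  \<open>x\<close> to \<open>y\<close> is nonnegative and vanishes at \<open>t = 0\<close>. Its right derivative there is therefore
  nonnegative, which is the first-order inequality.\<close>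

lemma strongly_convex_gradient_inequality:
  fixes f :: "'a::euclidean_space \<Rightarrow> real"
  assumes sc: "strongly_convex_on UNIV c f" and diff: "f differentiable (at x)"
  shows "f x + grad f x \<bullet> (y - x) + c / 2 * (norm (x - y))\<^sup>2 \<le> f y"
proof -
  define \<phi> where "\<phi> t = (1 - t) * f x + t * f y - c / 2 * t * (1 - t) * (norm (x - y))\<^sup>2
    - f (x + t *\<^sub>R (y - x))" for t :: real
  have nonneg: "0 \<le> \<phi> t" if "0 \<le> t" "t \<le> 1" for t
  proof -
    have "x + t *\<^sub>R (y - x) = (1 - t) *\<^sub>R x + t *\<^sub>R y"
      by (simp add: algebra_simps)
    then show ?thesis
      using sc that unfolding strongly_convex_on_def \<phi>_def by simp
  qed
  have "\<phi> 0 = 0"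
    by (simp add: \<phi>_def)
  have deriv: "(\<phi> has_real_derivative
      f y - f x - c / 2 * (norm (x - y))\<^sup>2 - grad f x \<bullet> (y - x)) (at 0)"
    unfolding \<phi>_def using DERIV_along_line[OF diff, of "y - x"]
    by (auto intro!: derivative_eq_intros)
  have "0 \<le> f y - f x - c / 2 * (norm (x - y))\<^sup>2 - grad f x \<bullet> (y - x)"
  proof (rule ccontr)
    assume "\<not> 0 \<le> f y - f x - c / 2 * (norm (x - y))\<^sup>2 - grad f x \<bullet> (y - x)"
    then obtain d where "d > 0" and dec: "\<And>h. 0 < h \<Longrightarrow> h < d \<Longrightarrow> \<phi> h < 0"
      using DERIV_neg_dec_right[OF deriv] \<open>\<phi> 0 = 0\<close> by auto
    have "\<phi> (min (d / 2) 1) < 0"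
      using \<open>d > 0\<close> by (intro dec) auto
    moreover have "0 \<le> \<phi> (min (d / 2) 1)"
      using \<open>d > 0\<close> by (intro nonneg) auto
    ultimately show False
      by simp
  qed
  then show ?thesis
    by simp
qed

text \<open>Strong monotonicity of the gradient against the zero gradient at the minimizer: add the
  gradient inequalities from \<open>x\<close> to \<open>z\<close> and from \<open>z\<close> to \<open>x\<close>. This supplies the contraction
  \<open>2c\<gamma>\<close> per step.\<close>

lemma strongly_convex_grad_monotone_at_minimum:
  fixes f :: "'a::euclidean_space \<Rightarrow> real"
  assumes sc: "strongly_convex_on UNIV c f" and diff: "\<And>y. f differentiable (at y)"
    and min: "\<And>y. f z \<le> f y"
  shows "c * (norm (x - z))\<^sup>2 \<le> (x - z) \<bullet> grad f x"
  using strongly_convex_gradient_inequality[OF sc diff, of x z]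
    strongly_convex_gradient_inequality[OF sc diff, of z x]
    grad_eq_0_at_minimum[OF diff min]
  by (simp add: norm_minus_commute inner_diff_right inner_commute[of "grad f x"] inner_diff_left)

section \<open>Measurability of stochastic gradients\<close>

text \<open>A function that is continuous in one argument and measurable in the other (a Caratheodory
  function) stays measurable when measurable maps are substituted into both. Replace the first
  argument by the first point, in an enumeration of a countable dense set, at distance less than
  \<open>1/(n + 1)\<close>: it takes countably many values, so the composition is measurable, and continuity gives
  the limit \<open>n \<rightarrow> \<infinity>\<close>.\<close>

lemma measurable_Caratheodory_compose:
  fixes f :: "'a::{metric_space, second_countable_topology} \<Rightarrow> 'b \<Rightarrow> 'c::metric_space"
  assumes cont: "\<And>s. continuous_on UNIV (\<lambda>y. f y s)"
    and meas: "\<And>y. f y \<in> measurable N borel"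
    and g: "g \<in> borel_measurable M" and s: "s \<in> measurable M N"
  shows "(\<lambda>\<omega>. f (g \<omega>) (s \<omega>)) \<in> borel_measurable M"
proof -
  obtain D :: "'a set" where D: "countable D"
    and dense: "\<And>X. open X \<Longrightarrow> X \<noteq> {} \<Longrightarrow> \<exists>d\<in>D. d \<in> X"
    by (rule countable_dense_setE) blast
  define d where "d = from_nat_into D"
  define near where "near n y = (LEAST i. dist (d i) y < 1 / real (Suc n))" for n y
  have dist_near: "dist (d (near n y)) y < 1 / real (Suc n)" for n y
  proof -
    have "\<exists>z\<in>D. z \<in> ball y (1 / real (Suc n))"
      by (rule dense) (auto intro: exI[of _ y])
    then obtain z where "z \<in> D" "dist z y < 1 / real (Suc n)"
      by (auto simp: dist_commute)
    moreover obtain i where "d i = z"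
      using from_nat_into_surj[OF D \<open>z \<in> D\<close>] by (auto simp: d_def)
    ultimately have "dist (d i) y < 1 / real (Suc n)"
      by simp
    then show ?thesis
      unfolding near_def by (rule LeastI)
  qed
  show ?thesis
  proof (rule borel_measurable_LIMSEQ_metric)
    fix n
    have "(\<lambda>\<omega>. near n (g \<omega>)) \<in> measurable M (count_space UNIV)"
      unfolding near_def using g by measurable
    then show "(\<lambda>\<omega>. f (d (near n (g \<omega>))) (s \<omega>)) \<in> borel_measurable M"
      by (rule measurable_compose_countable[rotated]) (rule measurable_compose[OF s meas])
  next
    fix \<omega>
    have "(\<lambda>n. d (near n (g \<omega>))) \<longlonglongrightarrow> g \<omega>"
      by (rule metric_tendsto_imp_tendsto[OF LIMSEQ_inverse_real_of_nat])
        (use dist_near[of _ "g \<omega>"] in \<open>auto simp: inverse_eq_divide intro!: always_eventually less_imp_le\<close>)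
    then show "(\<lambda>n. f (d (near n (g \<omega>))) (s \<omega>)) \<longlonglongrightarrow> f (g \<omega>) (s \<omega>)"
      using cont[of "s \<omega>"] by (auto intro: continuous_on_tendsto_compose)
  qed
qed

text \<open>Each component of the gradient is a limit of difference quotients, and these are measurable
  by the Caratheodory property. This makes
  the stochastic gradients, hence the iterates and the noise, random variables.\<close>

lemma measurable_grad_compose:
  fixes f :: "'a::euclidean_space \<Rightarrow> 'b \<Rightarrow> real"
  assumes diff: "\<And>y s. (\<lambda>z. f z s) differentiable (at y)"
    and meas: "\<And>y. f y \<in> measurable N borel"
    and g[measurable]: "g \<in> borel_measurable M" and s: "s \<in> measurable M N"
  shows "(\<lambda>\<omega>. grad (\<lambda>y. f y (s \<omega>)) (g \<omega>)) \<in> borel_measurable M"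
proof (subst borel_measurable_euclidean_space, rule ballI)
  fix b :: 'a
  have cont: "continuous_on UNIV (\<lambda>y. f y s)" for s
    by (intro differentiable_imp_continuous_on differentiable_at_imp_differentiable_on diff)
  show "(\<lambda>\<omega>. grad (\<lambda>y. f y (s \<omega>)) (g \<omega>) \<bullet> b) \<in> borel_measurable M"
  proof (rule borel_measurable_LIMSEQ_real)
    fix n
    have [measurable]: "(\<lambda>\<omega>. f (g \<omega> + inverse (real (Suc n)) *\<^sub>R b) (s \<omega>)) \<in> borel_measurable M"
      "(\<lambda>\<omega>. f (g \<omega>) (s \<omega>)) \<in> borel_measurable M"
      by (rule measurable_Caratheodory_compose[OF cont meas _ s]; measurable)+
    show "(\<lambda>\<omega>. (f (g \<omega> + inverse (real (Suc n)) *\<^sub>R b) (s \<omega>) - f (g \<omega>) (s \<omega>))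
      / inverse (real (Suc n))) \<in> borel_measurable M"
      by measurable
  next
    fix \<omega>
    have "((\<lambda>h. (f (g \<omega> + h *\<^sub>R b) (s \<omega>) - f (g \<omega>) (s \<omega>)) / h)
      \<longlongrightarrow> grad (\<lambda>y. f y (s \<omega>)) (g \<omega>) \<bullet> b) (at 0)"
      using DERIV_along_line[OF diff[where y = "g \<omega>" and s = "s \<omega>"], of b] by (simp add: DERIV_def)
    moreover have "filterlim (\<lambda>n. inverse (real (Suc n))) (at 0) sequentially"
      using LIMSEQ_inverse_real_of_nat by (auto simp: filterlim_at)
    ultimately show "(\<lambda>n. (f (g \<omega> + inverse (real (Suc n)) *\<^sub>R b) (s \<omega>) - f (g \<omega>) (s \<omega>))
      / inverse (real (Suc n))) \<longlonglongrightarrow> grad (\<lambda>y. f y (s \<omega>)) (g \<omega>) \<bullet> b"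
      by (rule filterlim_compose)
  qed
qed

section \<open>The history of the scheme\<close>

lemma space_history [simp]: "space (history P x \<xi> k) = space P"
  unfolding history_def by (rule space_measure_of) auto

lemma sets_history:
  "sets (history P x \<xi> k) = sigma_sets (space P)
     ({x 1 -` A \<inter> space P | A. A \<in> sets borel} \<union>
      {\<xi> i -` A \<inter> space P | i A. 1 \<le> i \<and> i < k \<and> A \<in> sets borel})"
  unfolding history_def by (rule sets_measure_of) auto

lemma subalgebra_history:
  assumes "x 1 \<in> borel_measurable P" and "\<And>i. i \<ge> 1 \<Longrightarrow> \<xi> i \<in> borel_measurable P"
  shows "subalgebra P (history P x \<xi> k)"
  unfolding subalgebra_def sets_history
  by (auto intro!: sets.sigma_sets_subset measurable_sets[OF assms(1)] measurable_sets[OF assms(2)]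
    simp del: One_nat_def)

lemma measurable_history_initial: "x 1 \<in> borel_measurable (history P x \<xi> k)"
  by (rule measurableI)
    (auto simp: sets_history simp del: One_nat_def intro!: sigma_sets.Basic)

lemma measurable_history_noise:
  "1 \<le> i \<Longrightarrow> i < k \<Longrightarrow> \<xi> i \<in> borel_measurable (history P x \<xi> k)"
  by (rule measurableI) (auto simp: sets_history intro!: sigma_sets.Basic)

lemma sets_history_mono: "j \<le> k \<Longrightarrow> sets (history P x \<xi> j) \<subseteq> sets (history P x \<xi> k)"
  unfolding sets_history by (rule sigma_sets_mono', rule Un_mono) (auto intro: less_le_trans)

text \<open>The \<open>k\<close>-th iterate of a stochastic recursion depends on the starting point and on the first
  \<open>k - 1\<close> samples only. Hence factors built from it can be moved through the conditional
  expectation given the history.\<close>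

lemma measurable_history_iterates:
  fixes P :: "'w measure"
  assumes rec: "\<And>k \<omega>. k \<ge> 1 \<Longrightarrow> \<omega> \<in> space P \<Longrightarrow> x (k + 1) \<omega> = h k (x k \<omega>) (\<xi> k \<omega>)"
    and h: "\<And>k (M :: 'w measure) g s. k \<ge> 1 \<Longrightarrow> g \<in> borel_measurable M \<Longrightarrow> s \<in> borel_measurable M \<Longrightarrow>
      (\<lambda>\<omega>. h k (g \<omega>) (s \<omega>)) \<in> borel_measurable M"
    and "k \<ge> 1"
  shows "x k \<in> borel_measurable (history P x \<xi> k)"
  using \<open>k \<ge> 1\<close>
proof (induction rule: dec_induct)
  case base
  show ?case
    by (rule measurable_history_initial)
next
  case (step n)
  have "x n \<in> borel_measurable (history P x \<xi> (Suc n))"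
    by (rule measurable_mono[THEN subsetD, OF _ _ _ _ step.IH])
      (simp_all add: sets_history_mono)
  moreover have "\<xi> n \<in> borel_measurable (history P x \<xi> (Suc n))"
    using step.hyps by (intro measurable_history_noise) auto
  ultimately have "(\<lambda>\<omega>. h n (x n \<omega>) (\<xi> n \<omega>)) \<in> borel_measurable (history P x \<xi> (Suc n))"
    using step.hyps by (intro h) auto
  then show ?case
    by (subst measurable_cong[where g = "\<lambda>\<omega>. h n (x n \<omega>) (\<xi> n \<omega>)"])
      (use rec[of n] step in simp_all)
qed

section \<open>Orthogonality and variance of the noise\<close>

lemma integrable_inner_of_square_integrable:
  fixes f g :: "'w \<Rightarrow> 'a::euclidean_space"
  assumes [measurable]: "f \<in> borel_measurable M" "g \<in> borel_measurable M"
    and "integrable M (\<lambda>\<omega>. (norm (f \<omega>))\<^sup>2)" "integrable M (\<lambda>\<omega>. (norm (g \<omega>))\<^sup>2)"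
  shows "integrable M (\<lambda>\<omega>. f \<omega> \<bullet> g \<omega>)"
proof (rule Bochner_Integration.integrable_bound)
  show "integrable M (\<lambda>\<omega>. (norm (f \<omega>))\<^sup>2 + (norm (g \<omega>))\<^sup>2)"
    using assms by simp
  show "AE \<omega> in M. norm (f \<omega> \<bullet> g \<omega>) \<le> norm ((norm (f \<omega>))\<^sup>2 + (norm (g \<omega>))\<^sup>2)"
  proof (rule AE_I2)
    fix \<omega>
    have "\<bar>f \<omega> \<bullet> g \<omega>\<bar> \<le> norm (f \<omega>) * norm (g \<omega>)"
      by (rule Cauchy_Schwarz_ineq2)
    also have "\<dots> \<le> (norm (f \<omega>))\<^sup>2 + (norm (g \<omega>))\<^sup>2"
      using sum_squares_bound[of "norm (f \<omega>)" "norm (g \<omega>)"]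
        mult_nonneg_nonneg[OF norm_ge_zero norm_ge_zero, of "f \<omega>" "g \<omega>"]
      by linarith
    finally show "norm (f \<omega> \<bullet> g \<omega>) \<le> norm ((norm (f \<omega>))\<^sup>2 + (norm (g \<omega>))\<^sup>2)"
      by simp
  qed
qed measurable

text \<open>Conditionally centred noise is orthogonal in \<open>L\<^sup>2\<close> to everything that is determined by the
  conditioning \<open>\<sigma>\<close>-algebra. Square integrability makes the componentwise products integrable, so
  that the defining property of the real conditional expectation applies to each of them.\<close>

lemma integral_inner_eq_0_of_vec_cond_exp_eq_0:
  fixes U W :: "'w \<Rightarrow> real ^ 'n"
  assumes "finite_measure_subalgebra P G"
    and U[measurable]: "U \<in> borel_measurable G" and W[measurable]: "W \<in> borel_measurable P"
    and U2: "integrable P (\<lambda>\<omega>. (norm (U \<omega>))\<^sup>2)" and W2: "integrable P (\<lambda>\<omega>. (norm (W \<omega>))\<^sup>2)"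
    and zero: "AE \<omega> in P. vec_cond_exp P G W \<omega> = 0"
  shows "(\<integral>\<omega>. U \<omega> \<bullet> W \<omega> \<partial>P) = 0"
proof -
  interpret finite_measure_subalgebra P G
    by fact
  have UP[measurable]: "U \<in> borel_measurable P"
    by (rule measurable_from_subalg[OF subalg U])
  have nth [measurable]: "(\<lambda>v :: real ^ 'n. v $ i) \<in> borel_measurable borel" for i
    by (intro borel_measurable_continuous_onI continuous_intros)
  have measG: "(\<lambda>\<omega>. U \<omega> $ i) \<in> borel_measurable G" for i
    by (rule measurable_compose[OF U nth])
  have measP [measurable]: "(\<lambda>\<omega>. U \<omega> $ i) \<in> borel_measurable P" "(\<lambda>\<omega>. W \<omega> $ i) \<in> borel_measurable P" for i
    by (rule measurable_compose[OF UP nth], rule measurable_compose[OF W nth])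
  have square_component: "integrable P (\<lambda>\<omega>. (norm (V \<omega> $ i))\<^sup>2)"
    if [measurable]: "(\<lambda>\<omega>. V \<omega> $ i) \<in> borel_measurable P" and "integrable P (\<lambda>\<omega>. (norm (V \<omega>))\<^sup>2)"
    for V :: "'w \<Rightarrow> real ^ 'n" and i
  proof (rule Bochner_Integration.integrable_bound[OF that(2)])
    show "AE \<omega> in P. norm ((norm (V \<omega> $ i))\<^sup>2) \<le> norm ((norm (V \<omega>))\<^sup>2)"
    proof (rule AE_I2)
      fix \<omega>
      have "(norm (V \<omega> $ i))\<^sup>2 \<le> (norm (V \<omega>))\<^sup>2"
        using component_le_norm_cart[of "V \<omega>" i] by (intro power_mono) auto
      then show "norm ((norm (V \<omega> $ i))\<^sup>2) \<le> norm ((norm (V \<omega>))\<^sup>2)"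
        by simp
    qed
  qed measurable
  have int: "integrable P (\<lambda>\<omega>. U \<omega> $ i * W \<omega> $ i)" for i
    using integrable_inner_of_square_integrable[of "\<lambda>\<omega>. U \<omega> $ i" P "\<lambda>\<omega>. W \<omega> $ i"]
      square_component[OF _ U2] square_component[OF _ W2] by simp
  have "(\<integral>\<omega>. U \<omega> $ i * W \<omega> $ i \<partial>P) = 0" for i
  proof -
    have "(\<integral>\<omega>. U \<omega> $ i * W \<omega> $ i \<partial>P)
        = (\<integral>\<omega>. U \<omega> $ i * real_cond_exp P G (\<lambda>\<omega>'. W \<omega>' $ i) \<omega> \<partial>P)"
      using real_cond_exp_intg(2)[OF int measG] by simp
    also have "\<dots> = (\<integral>\<omega>. 0 \<partial>P)"
    proof (rule integral_cong_AE)
      show "AE \<omega> in P. U \<omega> $ i * real_cond_exp P G (\<lambda>\<omega>'. W \<omega>' $ i) \<omega> = 0"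
        using zero by eventually_elim (simp add: vec_cond_exp_def vec_eq_iff)
    qed measurable
    finally show ?thesis
      by simp
  qed
  then show ?thesis
    using int by (simp add: inner_vec_def)
qed

text \<open>A conditional bound becomes an unconditional one by the tower property; it also yields
  integrability, which makes square integrability of the noise a consequence of square
  integrability of the iterate.\<close>

lemma integrable_of_nn_cond_exp_le:
  fixes f g :: "'w \<Rightarrow> real"
  assumes "finite_measure_subalgebra P G"
    and [measurable]: "f \<in> borel_measurable P"
    and f: "\<And>\<omega>. 0 \<le> f \<omega>" and g: "\<And>\<omega>. 0 \<le> g \<omega>" "integrable P g"
    and le: "AE \<omega> in P. nn_cond_exp P G (\<lambda>\<omega>'. ennreal (f \<omega>')) \<omega> \<le> ennreal (g \<omega>)"
  shows "integrable P f" and "(\<integral>\<omega>. f \<omega> \<partial>P) \<le> (\<integral>\<omega>. g \<omega> \<partial>P)"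
proof -
  interpret finite_measure_subalgebra P G
    by fact
  have "(\<integral>\<^sup>+\<omega>. ennreal (f \<omega>) \<partial>P) = (\<integral>\<^sup>+\<omega>. nn_cond_exp P G (\<lambda>\<omega>'. ennreal (f \<omega>')) \<omega> \<partial>P)"
    using nn_cond_exp_intg[of "\<lambda>_. 1" "\<lambda>\<omega>. ennreal (f \<omega>)"] by simp
  also have "\<dots> \<le> (\<integral>\<^sup>+\<omega>. ennreal (g \<omega>) \<partial>P)"
    by (rule nn_integral_mono_AE[OF le])
  also have "\<dots> = ennreal (\<integral>\<omega>. g \<omega> \<partial>P)"
    using g by (intro nn_integral_eq_integral) auto
  finally have bound: "(\<integral>\<^sup>+\<omega>. ennreal (f \<omega>) \<partial>P) \<le> ennreal (\<integral>\<omega>. g \<omega> \<partial>P)" .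
  show int: "integrable P f"
    using f bound by (intro integrableI_nonneg) (auto intro: le_less_trans)
  have "ennreal (\<integral>\<omega>. f \<omega> \<partial>P) \<le> ennreal (\<integral>\<omega>. g \<omega> \<partial>P)"
    using bound nn_integral_eq_integral[OF int] f by simp
  then show "(\<integral>\<omega>. f \<omega> \<partial>P) \<le> (\<integral>\<omega>. g \<omega> \<partial>P)"
    using g by (subst (asm) ennreal_le_iff) (auto intro: integral_nonneg_AE)
qed

text \<open>Young's inequality for the cross term. Applied to \<open>x = (x - x\<^sup>*) + x\<^sup>*\<close>, it turns the
  noise bound in terms of \<open>\<parallel>x\<parallel>\<^sup>2\<close> into one in terms of \<open>\<parallel>x - x\<^sup>*\<parallel>\<^sup>2\<close>; this is where the free
  parameter \<open>r\<close> enters the constants.\<close>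

lemma norm_sum_square_le_weighted:
  fixes a b :: "'a::real_inner"
  assumes "r > 0"
  shows "(norm (a + b))\<^sup>2 \<le> (1 + 1 / r) * (norm a)\<^sup>2 + (1 + r) * (norm b)\<^sup>2"
proof -
  have "0 \<le> (norm (a /\<^sub>R sqrt r - sqrt r *\<^sub>R b))\<^sup>2"
    by simp
  also have "\<dots> = (norm a)\<^sup>2 / r + r * (norm b)\<^sup>2 - 2 * (a \<bullet> b)"
    using assms by (simp add: power2_norm_eq_inner inner_diff_left inner_diff_right inner_commute
        field_simps real_sqrt_mult_self flip: power2_eq_square)
  finally show ?thesis
    by (simp add: power2_norm_eq_inner inner_add_left inner_add_right inner_commute algebra_simps)
qed

section \<open>The mean square error recursion\<close>

text \<open>One step of the scheme, with \<open>g\<close> in the role of the exact gradient and \<open>W\<close> in the role of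
  the noise. The new error is \<open>U - \<gamma>W\<close>, where \<open>U = (X - z) - \<gamma> g(X)\<close> is the error after a
  noiseless step. The two parts are orthogonal, so the mean squares add up; strong monotonicity and
  the Lipschitz bound control \<open>U\<close>, the conditional variance bound controls \<open>W\<close>.\<close>

lemma mean_square_error_step:
  fixes X W :: "'w \<Rightarrow> real ^ 'n" and g :: "real ^ 'n \<Rightarrow> real ^ 'n"
  assumes fin: "finite_measure_subalgebra P G" and "prob_space P"
    and X[measurable]: "X \<in> borel_measurable G" and W[measurable]: "W \<in> borel_measurable P"
    and g[measurable]: "g \<in> borel_measurable borel"
    and mono: "\<And>y. c * (norm (y - z))\<^sup>2 \<le> (y - z) \<bullet> g y"
    and lip: "\<And>y. norm (g y) \<le> L * norm (y - z)"
    and zero: "AE \<omega> in P. vec_cond_exp P G W \<omega> = 0"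
    and var: "AE \<omega> in P. nn_cond_exp P G (\<lambda>\<omega>'. ennreal ((norm (W \<omega>'))\<^sup>2)) \<omega>
      \<le> ennreal (v1 * (norm (X \<omega>))\<^sup>2 + v2)"
    and nonneg: "0 \<le> v1" "0 \<le> v2" "0 < r" "0 \<le> \<gamma>"
    and int: "integrable P (\<lambda>\<omega>. (norm (X \<omega> - z))\<^sup>2)"
  shows "integrable P (\<lambda>\<omega>. (norm (X \<omega> - \<gamma> *\<^sub>R (g (X \<omega>) + W \<omega>) - z))\<^sup>2)" (is ?int)
    and "(\<integral>\<omega>. (norm (X \<omega> - \<gamma> *\<^sub>R (g (X \<omega>) + W \<omega>) - z))\<^sup>2 \<partial>P)
      \<le> (1 - 2 * c * \<gamma> + \<gamma>\<^sup>2 * (L\<^sup>2 + v1 * (1 + 1 / r))) * (\<integral>\<omega>. (norm (X \<omega> - z))\<^sup>2 \<partial>P)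
        + \<gamma>\<^sup>2 * (v1 * (1 + r) * (norm z)\<^sup>2 + v2)" (is ?le)
proof -
  interpret finite_measure_subalgebra P G
    by fact
  interpret prob_space P
    by fact
  have XP[measurable]: "X \<in> borel_measurable P"
    by (rule measurable_from_subalg[OF subalg X])
  define U where "U \<omega> = (X \<omega> - z) - \<gamma> *\<^sub>R g (X \<omega>)" for \<omega>
  have UG[measurable]: "U \<in> borel_measurable G"
    unfolding U_def by measurable
  have UP[measurable]: "U \<in> borel_measurable P"
    by (rule measurable_from_subalg[OF subalg UG])
  have U_le: "(norm (U \<omega>))\<^sup>2 \<le> (1 - 2 * c * \<gamma> + \<gamma>\<^sup>2 * L\<^sup>2) * (norm (X \<omega> - z))\<^sup>2" for \<omega>
  proof -
    have "(norm (U \<omega>))\<^sup>2 = (norm (X \<omega> - z))\<^sup>2 - 2 * \<gamma> * ((X \<omega> - z) \<bullet> g (X \<omega>)) + \<gamma>\<^sup>2 * (norm (g (X \<omega>)))\<^sup>2"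
      unfolding U_def by (simp only: power2_norm_eq_inner)
        (simp add: inner_diff_left inner_diff_right inner_commute algebra_simps power2_eq_square)
    moreover have "\<gamma> * (c * (norm (X \<omega> - z))\<^sup>2) \<le> \<gamma> * ((X \<omega> - z) \<bullet> g (X \<omega>))"
      using mono nonneg by (intro mult_left_mono)
    moreover have "\<gamma>\<^sup>2 * (norm (g (X \<omega>)))\<^sup>2 \<le> \<gamma>\<^sup>2 * (L * norm (X \<omega> - z))\<^sup>2"
      using lip by (intro mult_left_mono power_mono) auto
    ultimately show ?thesis
      by (simp add: algebra_simps power_mult_distrib)
  qed
  have U2: "integrable P (\<lambda>\<omega>. (norm (U \<omega>))\<^sup>2)"
  proof (rule Bochner_Integration.integrable_bound)
    show "integrable P (\<lambda>\<omega>. (1 - 2 * c * \<gamma> + \<gamma>\<^sup>2 * L\<^sup>2) * (norm (X \<omega> - z))\<^sup>2)"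
      using int by simp
    show "AE \<omega> in P. norm ((norm (U \<omega>))\<^sup>2) \<le> norm ((1 - 2 * c * \<gamma> + \<gamma>\<^sup>2 * L\<^sup>2) * (norm (X \<omega> - z))\<^sup>2)"
      by (rule AE_I2) (simp add: order_trans[OF U_le abs_ge_self])
  qed measurable
  define B where "B \<omega> = v1 * (1 + 1 / r) * (norm (X \<omega> - z))\<^sup>2 + (v1 * (1 + r) * (norm z)\<^sup>2 + v2)" for \<omega>
  have B_int: "integrable P B"
    unfolding B_def using int by simp
  have X_le_B: "v1 * (norm (X \<omega>))\<^sup>2 + v2 \<le> B \<omega>" for \<omega>
  proof -
    have "v1 * (norm (X \<omega>))\<^sup>2 \<le> v1 * ((1 + 1 / r) * (norm (X \<omega> - z))\<^sup>2 + (1 + r) * (norm z)\<^sup>2)"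
      using norm_sum_square_le_weighted[OF \<open>0 < r\<close>, of "X \<omega> - z" z] nonneg by (intro mult_left_mono) auto
    then show ?thesis
      by (simp add: B_def algebra_simps)
  qed
  have B_nonneg: "0 \<le> B \<omega>" for \<omega>
  proof -
    have "0 \<le> v1 * (norm (X \<omega>))\<^sup>2 + v2"
      using nonneg by simp
    then show ?thesis
      using X_le_B[of \<omega>] by linarith
  qed
  have var_B: "AE \<omega> in P. nn_cond_exp P G (\<lambda>\<omega>'. ennreal ((norm (W \<omega>'))\<^sup>2)) \<omega> \<le> ennreal (B \<omega>)"
    using var by eventually_elim (meson X_le_B ennreal_leI order_trans)
  have W2: "integrable P (\<lambda>\<omega>. (norm (W \<omega>))\<^sup>2)" and W2_le: "(\<integral>\<omega>. (norm (W \<omega>))\<^sup>2 \<partial>P) \<le> (\<integral>\<omega>. B \<omega> \<partial>P)"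
    using integrable_of_nn_cond_exp_le[OF fin _ _ B_nonneg B_int var_B] by auto
  have UW: "integrable P (\<lambda>\<omega>. U \<omega> \<bullet> W \<omega>)"
    by (rule integrable_inner_of_square_integrable[OF UP W U2 W2])
  have UW_0: "(\<integral>\<omega>. U \<omega> \<bullet> W \<omega> \<partial>P) = 0"
    by (rule integral_inner_eq_0_of_vec_cond_exp_eq_0[OF fin UG W U2 W2 zero])
  have expand: "(\<lambda>\<omega>. (norm (X \<omega> - \<gamma> *\<^sub>R (g (X \<omega>) + W \<omega>) - z))\<^sup>2)
    = (\<lambda>\<omega>. (norm (U \<omega>))\<^sup>2 - 2 * \<gamma> * (U \<omega> \<bullet> W \<omega>) + \<gamma>\<^sup>2 * (norm (W \<omega>))\<^sup>2)"
  proof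
    fix \<omega>
    have "X \<omega> - \<gamma> *\<^sub>R (g (X \<omega>) + W \<omega>) - z = U \<omega> - \<gamma> *\<^sub>R W \<omega>"
      by (simp add: U_def algebra_simps)
    then show "(norm (X \<omega> - \<gamma> *\<^sub>R (g (X \<omega>) + W \<omega>) - z))\<^sup>2
      = (norm (U \<omega>))\<^sup>2 - 2 * \<gamma> * (U \<omega> \<bullet> W \<omega>) + \<gamma>\<^sup>2 * (norm (W \<omega>))\<^sup>2"
      by (simp only: power2_norm_eq_inner)
        (simp add: inner_diff_left inner_diff_right inner_commute algebra_simps power2_eq_square)
  qed
  show ?int
    unfolding expand using U2 UW W2 by simp
  have "(\<integral>\<omega>. (norm (X \<omega> - \<gamma> *\<^sub>R (g (X \<omega>) + W \<omega>) - z))\<^sup>2 \<partial>P)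
    = (\<integral>\<omega>. (norm (U \<omega>))\<^sup>2 \<partial>P) + \<gamma>\<^sup>2 * (\<integral>\<omega>. (norm (W \<omega>))\<^sup>2 \<partial>P)"
    unfolding expand using U2 UW W2 UW_0 by simp
  also have "\<dots> \<le> (\<integral>\<omega>. (1 - 2 * c * \<gamma> + \<gamma>\<^sup>2 * L\<^sup>2) * (norm (X \<omega> - z))\<^sup>2 \<partial>P) + \<gamma>\<^sup>2 * (\<integral>\<omega>. B \<omega> \<partial>P)"
    using U2 int by (intro add_mono mult_left_mono W2_le integral_mono U_le) auto
  also have "\<dots> = (1 - 2 * c * \<gamma> + \<gamma>\<^sup>2 * L\<^sup>2) * (\<integral>\<omega>. (norm (X \<omega> - z))\<^sup>2 \<partial>P)
      + \<gamma>\<^sup>2 * (v1 * (1 + 1 / r) * (\<integral>\<omega>. (norm (X \<omega> - z))\<^sup>2 \<partial>P) + (v1 * (1 + r) * (norm z)\<^sup>2 + v2))"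
    unfolding B_def using int by (simp add: prob_space)
  also have "\<dots> = (1 - 2 * c * \<gamma> + \<gamma>\<^sup>2 * (L\<^sup>2 + v1 * (1 + 1 / r))) * (\<integral>\<omega>. (norm (X \<omega> - z))\<^sup>2 \<partial>P)
      + \<gamma>\<^sup>2 * (v1 * (1 + r) * (norm z)\<^sup>2 + v2)"
    by (simp only: distrib_left distrib_right mult.assoc add.assoc)
  finally show ?le .
qed

text \<open>A form of Chung's lemma. If \<open>a\<^sub>k \<le> Q/k\<close>, the recursion gives
  \<open>a\<^sub>k\<^sub>+\<^sub>1 \<le> Q/k - ((\<mu> - \<beta>/k) Q - D)/k\<^sup>2\<close>. The bound \<open>D/(\<mu> - \<beta>/K - 1) \<le> Q\<close> says exactly
  that \<open>(\<mu> - \<beta>/K) Q - D \<ge> Q\<close>, and \<open>\<beta>/k \<le> \<beta>/K\<close>, so the right-hand side is at most \<open>Q/k - Q/k\<^sup>2 \<le> Q/(k + 1)\<close>. The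
  coefficient of \<open>a\<^sub>k\<close> has to be nonnegative for the induction hypothesis to be inserted.\<close>

lemma Chung_recursion_bound:
  fixes a :: "nat \<Rightarrow> real"
  assumes step: "\<And>k. k \<ge> K \<Longrightarrow>
      a (Suc k) \<le> (1 - \<mu> / real k + \<beta> / (real k)\<^sup>2) * a k + D / (real k)\<^sup>2"
    and coeff: "\<And>k. k \<ge> K \<Longrightarrow> 0 \<le> 1 - \<mu> / real k + \<beta> / (real k)\<^sup>2"
    and K: "K > 0" and "\<beta> \<ge> 0" and "D \<ge> 0"
    and gap: "\<mu> - \<beta> / real K - 1 > 0"
    and QD: "D / (\<mu> - \<beta> / real K - 1) \<le> Q" and QK: "real K * a K \<le> Q"
    and "k \<ge> K"
  shows "a k \<le> Q / real k"
  using \<open>k \<ge> K\<close>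
proof (induction rule: dec_induct)
  case base
  show ?case
    using QK K by (simp add: field_simps)
next
  case (step k)
  define \<kappa> where "\<kappa> = real k"
  have \<kappa>: "\<kappa> > 0" "real K \<le> \<kappa>"
    using step K by (auto simp: \<kappa>_def)
  have "0 \<le> D / (\<mu> - \<beta> / real K - 1)"
    using gap \<open>D \<ge> 0\<close> by (intro divide_nonneg_pos)
  then have "Q \<ge> 0"
    using QD by simp
  have "\<beta> / \<kappa> \<le> \<beta> / real K"
    using \<kappa> K \<open>\<beta> \<ge> 0\<close> by (intro divide_left_mono) auto
  then have "D + Q \<le> (\<mu> - \<beta> / \<kappa>) * Q"
    using QD gap \<open>Q \<ge> 0\<close> mult_right_mono[of "\<beta> / \<kappa>" "\<beta> / real K" Q]
    by (simp add: pos_divide_le_eq algebra_simps)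
  then have "(D + Q) / \<kappa>\<^sup>2 \<le> (\<mu> - \<beta> / \<kappa>) * Q / \<kappa>\<^sup>2"
    by (rule divide_right_mono) simp
  moreover have "(1 - \<mu> / \<kappa> + \<beta> / \<kappa>\<^sup>2) * (Q / \<kappa>) + D / \<kappa>\<^sup>2
    = Q / \<kappa> - Q / \<kappa>\<^sup>2 + ((D + Q) / \<kappa>\<^sup>2 - (\<mu> - \<beta> / \<kappa>) * Q / \<kappa>\<^sup>2)"
    using \<kappa> by (simp add: divide_simps) (simp add: algebra_simps power2_eq_square)
  ultimately have drift: "(1 - \<mu> / \<kappa> + \<beta> / \<kappa>\<^sup>2) * (Q / \<kappa>) + D / \<kappa>\<^sup>2 \<le> Q / \<kappa> - Q / \<kappa>\<^sup>2"
    by linarith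
  have "a (Suc k) \<le> (1 - \<mu> / \<kappa> + \<beta> / \<kappa>\<^sup>2) * a k + D / \<kappa>\<^sup>2"
    unfolding \<kappa>_def using step.hyps by (intro assms(1))
  also have "\<dots> \<le> (1 - \<mu> / \<kappa> + \<beta> / \<kappa>\<^sup>2) * (Q / \<kappa>) + D / \<kappa>\<^sup>2"
    unfolding \<kappa>_def using step by (intro add_mono mult_left_mono coeff) auto
  also have "\<dots> \<le> Q / \<kappa> - Q / \<kappa>\<^sup>2"
    by (rule drift)
  also have "\<dots> \<le> Q / (\<kappa> + 1)"
  proof -
    have "Q / (\<kappa> + 1) - (Q / \<kappa> - Q / \<kappa>\<^sup>2) = Q / (\<kappa>\<^sup>2 * (\<kappa> + 1))"
      using \<kappa> by (simp add: divide_simps) (simp add: algebra_simps power2_eq_square)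
    moreover have "0 \<le> Q / (\<kappa>\<^sup>2 * (\<kappa> + 1))"
      using \<open>Q \<ge> 0\<close> \<kappa> by simp
    ultimately show ?thesis
      by linarith
  qed
  finally show ?case
    by (simp add: \<kappa>_def add.commute)
qed

section \<open>The rate of convergence\<close>

theorem theorem3:
  fixes P :: "'w measure"
    and \<xi> :: "'w \<Rightarrow> real ^ 'd"
    and Ft :: "real ^ 'n \<Rightarrow> real ^ 'd \<Rightarrow> real"
    and F :: "real ^ 'n \<Rightarrow> real"
    and xstar :: "real ^ 'n"
    and \<xi>s :: "nat \<Rightarrow> 'w \<Rightarrow> real ^ 'd"
    and x w :: "nat \<Rightarrow> 'w \<Rightarrow> real ^ 'n"
    and \<gamma> :: "nat \<Rightarrow> real"
    and c L v1 v2 \<gamma>0 r M C :: real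
    and K :: nat
    and e :: "nat \<Rightarrow> ennreal"
    and Q :: ennreal
  assumes "prob_space P"
    and "\<xi> \<in> borel_measurable P"
    and "\<And>y. Ft y \<in> borel_measurable borel"
    and "\<And>y. integrable P (\<lambda>\<omega>. Ft y (\<xi> \<omega>))"
    and "\<And>y. F y = (\<integral>\<omega>. Ft y (\<xi> \<omega>) \<partial>P)"
    and "\<And>y. is_arg_min F (\<lambda>_. True) y \<longleftrightarrow> y = xstar"
    and "strongly_convex_on UNIV c F"
    and "\<And>y. F differentiable (at y)"
    and "L-lipschitz_on UNIV (grad F)"
    and "\<And>s. convex_on UNIV (\<lambda>y. Ft y s)"
    and "\<And>y s. (\<lambda>z. Ft z s) differentiable (at y)"
    and "x 1 \<in> borel_measurable P"
    and "\<And>k. k \<ge> 1 \<Longrightarrow> \<xi>s k \<in> borel_measurable P"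
    and "\<And>k \<omega>. k \<ge> 1 \<Longrightarrow> \<omega> \<in> space P \<Longrightarrow>
           w k \<omega> = grad (\<lambda>y. Ft y (\<xi>s k \<omega>)) (x k \<omega>) - grad F (x k \<omega>)"
    and "\<And>k. k \<ge> 1 \<Longrightarrow> AE \<omega> in P. vec_cond_exp P (history P x \<xi>s k) (w k) \<omega> = 0"
    and "v1 > 0" and "v2 > 0"
    and "\<And>k. k \<ge> 1 \<Longrightarrow>
           AE \<omega> in P. nn_cond_exp P (history P x \<xi>s k) (\<lambda>\<omega>'. ennreal ((norm (w k \<omega>'))\<^sup>2)) \<omega>
                         \<le> ennreal (v1 * (norm (x k \<omega>))\<^sup>2 + v2)"
    and "\<And>k \<omega>. k \<ge> 1 \<Longrightarrow> \<omega> \<in> space P \<Longrightarrow>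
           x (k + 1) \<omega> = x k \<omega> - \<gamma> k *\<^sub>R grad (\<lambda>y. Ft y (\<xi>s k \<omega>)) (x k \<omega>)"
    and "\<And>k. k \<ge> 1 \<Longrightarrow> \<gamma> k = \<gamma>0 / real k"
    and "\<gamma>0 > 1 / (2 * c)"
    and "r > 0"
    and "M = L\<^sup>2 + v1 * (1 + 1 / r)"
    and "C = v1 * (1 + r) * (norm xstar)\<^sup>2 + v2"
    and "\<And>k. e k = (\<integral>\<^sup>+\<omega>. ennreal ((norm (x k \<omega> - xstar))\<^sup>2) \<partial>P)"
    and "K = nat (\<lceil>\<gamma>0\<^sup>2 * M / (2 * c * \<gamma>0 - 1)\<rceil> + 1)"
    and "Q = max (ennreal (\<gamma>0\<^sup>2 * C / (2 * c * \<gamma>0 - \<gamma>0\<^sup>2 * M / real K - 1))) (of_nat K * e K)"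
  shows "\<forall>k\<ge>K. e k \<le> Q / of_nat k"
proof -
  interpret prob_space P
    by (rule assms(1))
  define G where "G k = history P x \<xi>s k" for k
  define a where "a k = (\<integral>\<omega>. (norm (x k \<omega> - xstar))\<^sup>2 \<partial>P)" for k
  have "c > 0"
    using assms(7) by (simp add: strongly_convex_on_def)
  have gap0: "2 * c * \<gamma>0 - 1 > 0"
    using assms(21) \<open>c > 0\<close> by (simp add: field_simps)
  have "1 / (2 * c) > 0"
    using \<open>c > 0\<close> by simp
  then have "\<gamma>0 > 0"
    using assms(21) by linarith
  have "M > 0"
    using assms(16,22) unfolding assms(23) by (intro add_nonneg_pos mult_pos_pos add_pos_pos) auto
  have "C > 0"
    using assms(16,17,22) unfolding assms(24) by (intro add_nonneg_pos mult_nonneg_nonneg) auto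

  have ratio_pos: "\<gamma>0\<^sup>2 * M / (2 * c * \<gamma>0 - 1) > 0"
    using gap0 \<open>M > 0\<close> \<open>\<gamma>0 > 0\<close> by simp
  then have ceil_pos: "\<lceil>\<gamma>0\<^sup>2 * M / (2 * c * \<gamma>0 - 1)\<rceil> > 0"
    by simp
  then have real_K: "real K = of_int \<lceil>\<gamma>0\<^sup>2 * M / (2 * c * \<gamma>0 - 1)\<rceil> + 1"
    unfolding assms(26) by simp
  then have "K \<ge> 1"
    using ceil_pos by linarith
  have "\<gamma>0\<^sup>2 * M / (2 * c * \<gamma>0 - 1) < real K"
    unfolding real_K by linarith
  then have gap: "2 * c * \<gamma>0 - \<gamma>0\<^sup>2 * M / real K - 1 > 0"
    using gap0 \<open>K \<ge> 1\<close> by (simp add: field_simps)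

  have min: "F xstar \<le> F y" for y
    using assms(6)[of xstar] by (auto simp: is_arg_min_def not_less)
  have mono: "c * (norm (y - xstar))\<^sup>2 \<le> (y - xstar) \<bullet> grad F y" for y
    by (rule strongly_convex_grad_monotone_at_minimum[OF assms(7,8) min])
  have lip: "norm (grad F y) \<le> L * norm (y - xstar)" for y
    using lipschitz_onD[OF assms(9), of y xstar] grad_eq_0_at_minimum[OF assms(8) min]
    by (simp add: dist_norm)
  \<comment> \<open>The Lipschitz bound dominates the monotonicity bound on any nonzero vector; this will make
    the coefficient in the recursion nonnegative.\<close>
  have "c \<le> L"
  proof -
    fix i :: 'n
    define d where "d = (axis i 1 :: real ^ 'n)"
    have "norm d = 1"
      by (simp add: d_def norm_axis_1)
    have "c \<le> d \<bullet> grad F (xstar + d)"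
      using mono[of "xstar + d"] \<open>norm d = 1\<close> by simp
    also have "\<dots> \<le> norm d * norm (grad F (xstar + d))"
      by (rule norm_cauchy_schwarz)
    also have "\<dots> \<le> L"
      using lip[of "xstar + d"] \<open>norm d = 1\<close> by simp
    finally show ?thesis .
  qed
  have gradF: "grad F \<in> borel_measurable borel"
    by (rule borel_measurable_continuous_onI) (rule lipschitz_on_continuous_on[OF assms(9)])

  have sub: "subalgebra P (G k)" for k
    unfolding G_def by (rule subalgebra_history[where x = x and \<xi> = \<xi>s, OF assms(12,13)])
  then have fin: "finite_measure_subalgebra P (G k)" for k
    by (simp add: finite_measure_subalgebra_def finite_measure_subalgebra_axioms_def finite_measure_axioms)
  have xG: "x k \<in> borel_measurable (G k)" if "k \<ge> 1" for k
    unfolding G_def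
  proof (rule measurable_history_iterates[where
        h = "\<lambda>k y s. y - \<gamma> k *\<^sub>R grad (\<lambda>z. Ft z s) y", OF _ _ that])
    show "x (k + 1) \<omega> = x k \<omega> - \<gamma> k *\<^sub>R grad (\<lambda>y. Ft y (\<xi>s k \<omega>)) (x k \<omega>)"
      if "k \<ge> 1" "\<omega> \<in> space P" for k \<omega>
      using that by (rule assms(19))
    show "(\<lambda>\<omega>. g \<omega> - \<gamma> k *\<^sub>R grad (\<lambda>y. Ft y (s \<omega>)) (g \<omega>)) \<in> borel_measurable M"
      if "g \<in> borel_measurable M" "s \<in> borel_measurable M" for k and M :: "'w measure" and g s
      by (intro borel_measurable_diff borel_measurable_scaleR borel_measurable_const that
          measurable_grad_compose[OF assms(11) assms(3)])
  qed
  have xP: "x k \<in> borel_measurable P" if "k \<ge> 1" for k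
    by (rule measurable_from_subalg[OF sub xG[OF that]])
  have wP: "w k \<in> borel_measurable P" if "k \<ge> 1" for k
  proof -
    have "(\<lambda>\<omega>. grad (\<lambda>y. Ft y (\<xi>s k \<omega>)) (x k \<omega>) - grad F (x k \<omega>)) \<in> borel_measurable P"
      by (intro borel_measurable_diff measurable_grad_compose[OF assms(11) assms(3)] xP assms(13)
          measurable_compose[OF xP gradF] that)
    then show ?thesis
      using assms(14)[OF that] by (simp cong: measurable_cong)
  qed

  have one_step: "integrable P (\<lambda>\<omega>. (norm (x (Suc k) \<omega> - xstar))\<^sup>2)
      \<and> a (Suc k) \<le> (1 - 2 * c * \<gamma>0 / real k + \<gamma>0\<^sup>2 * M / (real k)\<^sup>2) * a k + \<gamma>0\<^sup>2 * C / (real k)\<^sup>2"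
    if int: "integrable P (\<lambda>\<omega>. (norm (x k \<omega> - xstar))\<^sup>2)" and "k \<ge> 1" for k
  proof -
    have \<gamma>: "0 \<le> \<gamma> k"
      using assms(20)[OF \<open>k \<ge> 1\<close>] \<open>\<gamma>0 > 0\<close> by simp
    have next_iterate: "x (Suc k) \<omega> = x k \<omega> - \<gamma> k *\<^sub>R (grad F (x k \<omega>) + w k \<omega>)" if "\<omega> \<in> space P" for \<omega>
      using assms(14,19)[OF \<open>k \<ge> 1\<close> that] by simp
    have cong: "integrable P (\<lambda>\<omega>. (norm (x (Suc k) \<omega> - xstar))\<^sup>2)
        = integrable P (\<lambda>\<omega>. (norm (x k \<omega> - \<gamma> k *\<^sub>R (grad F (x k \<omega>) + w k \<omega>) - xstar))\<^sup>2)"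
      "a (Suc k) = (\<integral>\<omega>. (norm (x k \<omega> - \<gamma> k *\<^sub>R (grad F (x k \<omega>) + w k \<omega>) - xstar))\<^sup>2 \<partial>P)"
      unfolding a_def
      by (rule Bochner_Integration.integrable_cong, rule refl, simp add: next_iterate,
          rule Bochner_Integration.integral_cong, rule refl, simp add: next_iterate)
    note bound = mean_square_error_step[OF fin prob_space_axioms xG[OF \<open>k \<ge> 1\<close>] wP[OF \<open>k \<ge> 1\<close>] gradF
        mono lip assms(15)[OF \<open>k \<ge> 1\<close>, folded G_def] assms(18)[OF \<open>k \<ge> 1\<close>, folded G_def]
        less_imp_le[OF assms(16)] less_imp_le[OF assms(17)] assms(22) \<gamma> int]
    have "a (Suc k) \<le> (1 - 2 * c * \<gamma> k + (\<gamma> k)\<^sup>2 * M) * a k + (\<gamma> k)\<^sup>2 * C"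
      using bound(2) unfolding cong(2) unfolding a_def assms(23,24) .
    then show ?thesis
      using bound(1) unfolding cong(1) by (simp add: assms(20)[OF \<open>k \<ge> 1\<close>] power_divide)
  qed

  \<comment> \<open>If the mean square error at \<open>K\<close> is infinite, then so is \<open>Q\<close>. Otherwise all later errors
    are finite and the recursion can be read in the reals.\<close>
  show ?thesis
  proof (cases "e K = \<top>")
    case True
    then have "Q = \<top>"
      using \<open>K \<ge> 1\<close> unfolding assms(27) by (simp add: ennreal_mult_top)
    then show ?thesis
      by (simp add: ennreal_top_divide)
  next
    case False
    have int: "integrable P (\<lambda>\<omega>. (norm (x k \<omega> - xstar))\<^sup>2)" if "k \<ge> K" for k
      using that
    proof (induction rule: dec_induct)
      case base
      show ?case
        using False xP[OF \<open>K \<ge> 1\<close>] unfolding assms(25)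
        by (intro integrableI_nonneg) (auto simp: less_top)
    next
      case (step k)
      then show ?case
        using one_step \<open>K \<ge> 1\<close> by simp
    qed
    have e: "e k = ennreal (a k)" if "k \<ge> K" for k
      unfolding assms(25) a_def using int[OF that] by (intro nn_integral_eq_integral) auto
    have a_nonneg: "0 \<le> a k" for k
      unfolding a_def by simp
    define q where "q = max (\<gamma>0\<^sup>2 * C / (2 * c * \<gamma>0 - \<gamma>0\<^sup>2 * M / real K - 1)) (real K * a K)"
    have "0 \<le> q"
      unfolding q_def using a_nonneg by (simp add: max.coboundedI2)
    have "of_nat K * e K = ennreal (real K * a K)"
      unfolding e[OF order_refl] using a_nonneg
      by (simp only: ennreal_of_nat_eq_real_of_nat ennreal_mult of_nat_0_le_iff)
    moreover have "max (ennreal u) (ennreal v) = ennreal (max u v)" for u v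
      by (rule max_of_mono) (auto simp: mono_def ennreal_leI)
    ultimately have Q: "Q = ennreal q"
      unfolding assms(27) q_def by (simp only:)
    have a_le: "a k \<le> q / real k" if "k \<ge> K" for k
    proof (rule Chung_recursion_bound[OF _ _ _ _ _ gap _ _ that])
      fix k assume "k \<ge> K"
      then have "k \<ge> 1"
        using \<open>K \<ge> 1\<close> by simp
      then show "a (Suc k) \<le> (1 - 2 * c * \<gamma>0 / real k + \<gamma>0\<^sup>2 * M / (real k)\<^sup>2) * a k
          + \<gamma>0\<^sup>2 * C / (real k)\<^sup>2"
        using one_step int[OF \<open>k \<ge> K\<close>] by simp
      \<comment> \<open>Completing the square: \<open>1 - 2c\<gamma> + M\<gamma>\<^sup>2 \<ge> (1 - c\<gamma>)\<^sup>2\<close> because \<open>M \<ge> L\<^sup>2 \<ge> c\<^sup>2\<close>.\<close>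
      have "c\<^sup>2 \<le> L\<^sup>2"
        using \<open>c > 0\<close> \<open>c \<le> L\<close> by (intro power_mono) auto
      also have "L\<^sup>2 \<le> M"
        unfolding assms(23) using assms(16,22) by simp
      finally have "(\<gamma>0 / real k)\<^sup>2 * c\<^sup>2 \<le> (\<gamma>0 / real k)\<^sup>2 * M"
        by (intro mult_left_mono) auto
      moreover have "0 \<le> (1 - c * (\<gamma>0 / real k))\<^sup>2"
        by simp
      ultimately show "0 \<le> 1 - 2 * c * \<gamma>0 / real k + \<gamma>0\<^sup>2 * M / (real k)\<^sup>2"
        by (simp add: power2_diff power_divide power_mult_distrib mult.commute)
    qed (use \<open>K \<ge> 1\<close> \<open>M > 0\<close> \<open>C > 0\<close> in \<open>auto simp: q_def\<close>)
    show ?thesis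
    proof (intro allI impI)
      fix k assume "k \<ge> K"
      then have "k > 0"
        using \<open>K \<ge> 1\<close> by simp
      have "e k \<le> ennreal (q / real k)"
        unfolding e[OF \<open>k \<ge> K\<close>] by (intro ennreal_leI a_le \<open>k \<ge> K\<close>)
      also have "\<dots> = Q / of_nat k"
        unfolding Q using \<open>0 \<le> q\<close> \<open>k > 0\<close>
        by (simp add: divide_ennreal ennreal_of_nat_eq_real_of_nat)
      finally show "e k \<le> Q / of_nat k" .
    qed
  qed
qed

end
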